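(* Let $\lambda>0$, $\sigma_\eta>0$, $D>0$, and consider a planar circular array of $N$ antennas whose $n$th antenna has, relative to the reference location, distance $d_{n0}=D/2$, azimuth $\phi_{n0}=\pi/2$ and elevation $\theta_{n0}=2\pi n/N$, $n=0,\dots,N-1$. Let the source have generic spherical coordinates $(d,\theta,\phi)$, $d>0$, relative to the reference location. Let the measurement be $\mathbf{z}=h+\boldsymbol{\eta}\in\mathbb{R}^N$ with $\boldsymbol{\eta}\sim\mathcal{N}(\mathbf{0},\sigma_\eta^2\mathbf{I}_N)$, where $h$ is the differential-phase observation function (defined in the context), with the regularity convention on derivatives given in the context. Put $g_n=\sin\theta_{n0}\sin\theta\cos(\phi_{n0}-\phi)+\cos\theta_{n0}\cos\theta$, and for $\xi\in\{d,\theta,\phi\}$ let $\tilde J^{\mathrm D}(\xi)=\mathbb{E}_{\mathbf{z}\mid\xi}\left\{\left(\partial\ln p(\mathbf{z}\mid\xi)/\partial\xi\right)^2\right\}$ be the scalar Fisher information on $\xi$. Then $$\tilde J^{\mathrm D}(d)=\frac{4\pi^2}{\lambda^2\sigma_\eta^2}\sum_{n=0}^{N-1}\frac{8d^2+D^2(g_n^2+1)-8g_n dD-2(2d-g_nD)\sqrt{4d^2+D^2-4g_n dD}}{4d^2+D^2-4g_n dD},$$ $$\tilde J^{\mathrm D}(\theta)=\frac{4\pi^2}{\lambda^2\sigma_\eta^2}\sum_{n=0}^{N-1}\frac{d^2D^2}{D^2+4d^2-4g_n dD}\left(\frac{\partial g_n}{\partial\theta}\right)^2,$$ $$\tilde J^{\mathrm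 D}(\phi)=\frac{4\pi^2}{\lambda^2\sigma_\eta^2}\sum_{n=0}^{N-1}\frac{d^2D^2}{D^2+4d^2-4g_n dD}\left(\frac{\partial g_n}{\partial\phi}\right)^2.$$
   Context: Geometry: a point has spherical coordinates $(\rho,\theta,\phi)$ relative to the reference location $\mathbf{r}\in\mathbb{R}^3$ if it equals $\mathbf{r}+\rho(\cos\phi\sin\theta,\sin\phi\sin\theta,\cos\theta)^{\mathsf T}$ ($\rho\ge0$ the distance, $\theta$ the elevation, $\phi$ the azimuth; the elevation of an antenna is allowed to range over $[0,2\pi)$, so the circular array is a circle of diameter $D$ centred at $\mathbf{r}$ in the plane through $\mathbf{r}$ parallel to the $YZ$-plane). The antennas are at $\mathbf{q}_n$ and the source at $\mathbf{p}$. Observation model: $h=[h_0,\dots,h_{N-1}]^{\mathsf T}$ with $$h_n=\Delta\vartheta_n\bmod2\pi,\qquad\Delta\vartheta_n=\frac{2\pi}{\lambda}\Delta d_n,$$ $$\Delta d_n=\lVert\mathbf{p}-\mathbf{q}_n\rVert-\lVert\mathbf{p}-\mathbf{r}\rVert=d\left[\sqrt{1+\left(\frac{d_{n0}}{d}\right)^2-2\frac{d_{n0}}{d}g_n}-1\right].$$ The likelihood is $p(\mathbf{z}\mid\xi)=\mathcal{N}(\mathbf{z};h,\sigma_\eta^2\mathbf{I}_N)$, regarded as a function of the single parameter $\xi\in\{d,\theta,\phi\}$ with the other two coordinates fixed. Regularity convention: at the jump points of the modulo operation, the derivatives of $h_n$ are taken equal to the left and right derivatives; equivalently, in every derivative $h_n$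 is replaced by $\Delta\vartheta_n$. The source does not coincide with any antenna, so all denominators are positive. *)

theory Defs
  imports "HOL-Probability.Probability" "HOL-Library.Real_Mod"
begin

definition spherical_point :: "real ^ 3 \<Rightarrow> real \<Rightarrow> real \<Rightarrow> real \<Rightarrow> real ^ 3" where
  "spherical_point r \<rho> \<theta> \<phi> =
     r + \<rho> *\<^sub>R vector [cos \<phi> * sin \<theta>, sin \<phi> * sin \<theta>, cos \<theta>]"

definition antenna_elevation :: "nat \<Rightarrow> nat \<Rightarrow> real" where
  "antenna_elevation N n = 2 * pi * real n / real N"

definition antenna_azimuth :: real where
  "antenna_azimuth = pi / 2"

definition antenna_position :: "real ^ 3 \<Rightarrow> real \<Rightarrow> nat \<Rightarrow> nat \<Rightarrow> real ^ 3" where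
  "antenna_position r D N n =
     spherical_point r (D / 2) (antenna_elevation N n) antenna_azimuth"

definition path_difference :: "real ^ 3 \<Rightarrow> real ^ 3 \<Rightarrow> real ^ 3 \<Rightarrow> real" where
  "path_difference r p q = norm (p - q) - norm (p - r)"

definition phase_difference ::
  "real \<Rightarrow> real ^ 3 \<Rightarrow> real \<Rightarrow> nat \<Rightarrow> real \<Rightarrow> real \<Rightarrow> real \<Rightarrow> nat \<Rightarrow> real" where
  "phase_difference lam r D N d \<theta> \<phi> n =
     2 * pi / lam *
       path_difference r (spherical_point r d \<theta> \<phi>) (antenna_position r D N n)"

definition direction_factor :: "nat \<Rightarrow> nat \<Rightarrow> real \<Rightarrow> real \<Rightarrow> real" where
  "direction_factor N n \<theta> \<phi> =
     sin (antenna_elevation N n) * sin \<theta> * cos (antenna_azimuth - \<phi>)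
     + cos (antenna_elevation N n) * cos \<theta>"

definition wrapped :: "(nat \<Rightarrow> real) \<Rightarrow> nat \<Rightarrow> real" where
  "wrapped \<Theta> n = \<Theta> n rmod (2 * pi)"

text \<open>
  Points of \<open>\<real>\<^sup>N\<close> are functions on \<open>{..<N}\<close>. The density below is that of the normal
  distribution with mean \<open>\<mu>\<close> and covariance matrix \<open>\<sigma>\<^sup>2 I\<^sub>N\<close>.
\<close>

definition gauss_density :: "nat \<Rightarrow> real \<Rightarrow> (nat \<Rightarrow> real) \<Rightarrow> (nat \<Rightarrow> real) \<Rightarrow> real" where
  "gauss_density N \<sigma> \<mu> z =
     exp (- (\<Sum>n<N. (z n - \<mu> n)\<^sup>2) / (2 * \<sigma>\<^sup>2)) / sqrt ((2 * pi * \<sigma>\<^sup>2) ^ N)"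

definition gauss_measure :: "nat \<Rightarrow> real \<Rightarrow> (nat \<Rightarrow> real) \<Rightarrow> (nat \<Rightarrow> real) measure" where
  "gauss_measure N \<sigma> \<mu> =
     density (\<Pi>\<^sub>M n\<in>{..<N}. lborel) (\<lambda>z. ennreal (gauss_density N \<sigma> \<mu> z))"

text \<open>
  A one-parameter family \<open>\<Theta>\<close> of phase vectors is observed modulo \<open>2\<pi>\<close>. To differentiate at \<open>x\<close>,
  the components that sit at a jump of the modulo operation at \<open>x\<close> (where the observation is \<open>0\<close>)
  are replaced by the unwrapped phase, shifted by the constant multiple of \<open>2\<pi>\<close> that makes it
  agree with the observation at \<open>x\<close>; all other components are the wrapped observation itself.
  Without the shift the residual \<open>z - h\<close> in the score would no longer be centred.
\<close>

definition regular_obs :: "(real \<Rightarrow> nat \<Rightarrow> real) \<Rightarrow> real \<Rightarrow> real \<Rightarrow> nat \<Rightarrow> real" where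
  "regular_obs \<Theta> x y n =
     (if \<exists>k::int. \<Theta> x n = 2 * pi * of_int k then \<Theta> y n - \<Theta> x n else wrapped (\<Theta> y) n)"

lemma regular_obs_self: "regular_obs \<Theta> x x = wrapped (\<Theta> x)"
  by (auto simp: fun_eq_iff regular_obs_def wrapped_def rmod_def)

definition score :: "nat \<Rightarrow> real \<Rightarrow> (real \<Rightarrow> nat \<Rightarrow> real) \<Rightarrow> real \<Rightarrow> (nat \<Rightarrow> real) \<Rightarrow> real" where
  "score N \<sigma> \<Theta> x z = deriv (\<lambda>y. ln (gauss_density N \<sigma> (regular_obs \<Theta> x y) z)) x"

definition fisher_information :: "nat \<Rightarrow> real \<Rightarrow> (real \<Rightarrow> nat \<Rightarrow> real) \<Rightarrow> real \<Rightarrow> real" where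
  "fisher_information N \<sigma> \<Theta> x =
     (\<integral>z. (score N \<sigma> \<Theta> x z)\<^sup>2 \<partial>gauss_measure N \<sigma> (wrapped (\<Theta> x)))"

end

theory Submission
  imports Defs
begin

text \<open>
  Near the parameter value the regularized observation differs from the unwrapped phase by a
  constant, so the score is the linear form \<open>\<Sum>n. c n * (z n - h n) / \<sigma>\<^sup>2\<close> with \<open>c n\<close> the derivative
  of the \<open>n\<close>-th phase. The residuals \<open>z n - h n\<close> are uncorrelated with variance \<open>\<sigma>\<^sup>2\<close>, hence the
  Fisher information is \<open>(\<Sum>n. (c n)\<^sup>2) / \<sigma>\<^sup>2\<close>, and \<open>c n\<close> is computed from the law of cosines.
\<close>

section \<open>Second moments of the Gaussian measure\<close>

text \<open>The covariance matrix is a multiple of the identity, so the coordinates are independent.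
  This factorization reduces integrals over the product space to one-dimensional moments.\<close>

lemma gauss_density_eq_prod:
  assumes "\<sigma> > 0"
  shows "gauss_density N \<sigma> \<mu> z = (\<Prod>n<N. normal_density (\<mu> n) \<sigma> (z n))"
  by (simp add: gauss_density_def normal_density_def prod.distrib exp_sum[symmetric]
      sum_negf sum_divide_distrib real_sqrt_power prod_dividef power_one_over)

lemma has_bochner_integral_normal_moments:
  assumes "\<sigma> > 0"
  shows "has_bochner_integral lborel (\<lambda>x. normal_density \<mu> \<sigma> x) 1"
    and "has_bochner_integral lborel (\<lambda>x. normal_density \<mu> \<sigma> x * (x - \<mu>)) 0"
    and "has_bochner_integral lborel (\<lambda>x. normal_density \<mu> \<sigma> x * (x - \<mu>)\<^sup>2) (\<sigma>\<^sup>2)"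
  \<comment> \<open>The general formulas concern the powers \<open>2 * k\<close> and
    \<open>2 * k + 1\<close>. Total mass and variance are the even cases \<open>k = 0\<close> and
    \<open>k = 1\<close>, the mean is the odd case \<open>k = 0\<close>.\<close>
  using normal_moment_even[OF assms, of \<mu> 0] normal_moment_odd[OF assms, of \<mu> 0]
    normal_moment_even[OF assms, of \<mu> 1] assms
  by (simp_all add: numeral_2_eq_2 power_one_over)

text \<open>Density times residuals is a product of one-variable functions, so the integral is a
  product of one-dimensional moments. The \<open>has_bochner_integral\<close> form carries along the
  integrability needed for sums of such terms.\<close>

lemma has_bochner_integral_gauss_covariance:
  assumes \<sigma>: "\<sigma> > 0" and i: "i < N" and j: "j < N"
  shows "has_bochner_integral (gauss_measure N \<sigma> \<mu>)
    (\<lambda>z. (z i - \<mu> i) * (z j - \<mu> j)) (if i = j then \<sigma>\<^sup>2 else 0)"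
proof -
  interpret product_sigma_finite "\<lambda>_::nat. lborel :: real measure"
    by standard
  \<comment> \<open>One residual is attached for each of \<open>i\<close> and \<open>j\<close> that
    equals \<open>n\<close>, so coinciding indices give the square. \<open>m n\<close> below is the
    integral of \<open>f n\<close>: variance, mean residual or total mass.\<close>
  define f where "f n x = normal_density (\<mu> n) \<sigma> x * ((if n = i then x - \<mu> n else 1)
    * (if n = j then x - \<mu> n else 1))" for n x
  define m where "m n = (if n = i \<and> n = j then \<sigma>\<^sup>2 else if n = i \<or> n = j then 0 else 1)" for n
  have f: "has_bochner_integral lborel (f n) (m n)" for n
    using has_bochner_integral_normal_moments[OF \<sigma>, of "\<mu> n"]
    by (auto simp: f_def[abs_def] m_def power2_eq_square)
  have "has_bochner_integral (\<Pi>\<^sub>M n\<in>{..<N}. lborel) (\<lambda>z. \<Prod>n<N. f n (z n)) (\<Prod>n<N. m n)"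
    using product_integrable_prod[of "{..<N}" f] product_integral_prod[of "{..<N}" f] f
    by (simp add: has_bochner_integral_iff)
  moreover have "(\<Prod>n<N. f n (z n)) = gauss_density N \<sigma> \<mu> z *\<^sub>R ((z i - \<mu> i) * (z j - \<mu> j))" for z
    using i j by (simp add: f_def prod.distrib gauss_density_eq_prod[OF \<sigma>] prod.delta)
  moreover have "(\<Prod>n<N. m n) = (if i = j then \<sigma>\<^sup>2 else 0)"
  proof (cases "i = j")
    case True
    then have "(\<Prod>n<N. m n) = (\<Prod>n<N. if n = j then \<sigma>\<^sup>2 else 1)"
      by (intro prod.cong) (auto simp: m_def)
    then show ?thesis using True j by (simp add: prod.delta)
  next
    case False
    \<comment> \<open>For distinct indices the factor at \<open>i\<close> is a first central moment,
      which annihilates the product.\<close>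
    then have "m i = 0" by (simp add: m_def)
    then show ?thesis using False i by (auto intro!: prod_zero)
  qed
  ultimately have *: "has_bochner_integral (\<Pi>\<^sub>M n\<in>{..<N}. lborel)
    (\<lambda>z. gauss_density N \<sigma> \<mu> z *\<^sub>R ((z i - \<mu> i) * (z j - \<mu> j))) (if i = j then \<sigma>\<^sup>2 else 0)"
    by simp
  show ?thesis
    unfolding gauss_measure_def
  proof (rule has_bochner_integral_density[OF _ _ _ *])
    show "(\<lambda>z. (z i - \<mu> i) * (z j - \<mu> j)) \<in> borel_measurable (\<Pi>\<^sub>M n\<in>{..<N}. lborel)"
      using measurable_component_singleton[of _ "{..<N}" "\<lambda>_. lborel :: real measure"] i j
      by (intro borel_measurable_times borel_measurable_diff) auto
    show "gauss_density N \<sigma> \<mu> \<in> borel_measurable (\<Pi>\<^sub>M n\<in>{..<N}. lborel)"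
      unfolding gauss_density_def[abs_def] by measurable
    show "AE z in \<Pi>\<^sub>M n\<in>{..<N}. lborel. 0 \<le> gauss_density N \<sigma> \<mu> z"
      by (simp add: gauss_density_def)
  qed
qed

text \<open>Expanding the square gives a double sum over covariances, of which only the diagonal
  survives.\<close>

lemma integral_gauss_linear_squared:
  assumes \<sigma>: "\<sigma> > 0"
  shows "(\<integral>z. (\<Sum>n<N. a n * (z n - \<mu> n))\<^sup>2 \<partial>gauss_measure N \<sigma> \<mu>) = \<sigma>\<^sup>2 * (\<Sum>n<N. (a n)\<^sup>2)"
proof -
  have "has_bochner_integral (gauss_measure N \<sigma> \<mu>)
     (\<lambda>z. \<Sum>i<N. \<Sum>j<N. (a i * a j) * ((z i - \<mu> i) * (z j - \<mu> j)))
     (\<Sum>i<N. \<Sum>j<N. (a i * a j) * (if i = j then \<sigma>\<^sup>2 else 0))"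
    by (intro has_bochner_integral_sum has_bochner_integral_mult_right
        has_bochner_integral_gauss_covariance[OF \<sigma>]) auto
  moreover have "(\<Sum>i<N. \<Sum>j<N. (a i * a j) * ((z i - \<mu> i) * (z j - \<mu> j)))
      = (\<Sum>n<N. a n * (z n - \<mu> n))\<^sup>2" for z
    by (simp add: power2_eq_square sum_product ac_simps)
  moreover have "(\<Sum>i<N. \<Sum>j<N. (a i * a j) * (if i = j then \<sigma>\<^sup>2 else 0))
      = \<sigma>\<^sup>2 * (\<Sum>n<N. (a n)\<^sup>2)"
    by (simp add: if_distrib[of "(*) _"] sum.delta power2_eq_square sum_distrib_left ac_simps
        cong: if_cong)
  ultimately show ?thesis
    by (simp add: has_bochner_integral_iff)
qed

section \<open>The score and its second moment\<close>

text \<open>At a jump the regularized observation is the phase minus a constant by definition.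
  Elsewhere the number of removed turns is locally constant, so the same holds near
  \<open>x\<close>.\<close>

lemma regular_obs_has_real_derivative:
  assumes deriv: "((\<lambda>y. \<Theta> y n) has_real_derivative c) (at x)"
  shows "((\<lambda>y. regular_obs \<Theta> x y n) has_real_derivative c) (at x)"
proof (cases "\<exists>k::int. \<Theta> x n = 2 * pi * of_int k")
  case True
  then show ?thesis
    using deriv by (auto simp: regular_obs_def intro!: derivative_eq_intros)
next
  case False
  have nint: "\<Theta> x n / (2 * pi) \<notin> \<int>"
  proof
    assume "\<Theta> x n / (2 * pi) \<in> \<int>"
    then obtain k :: int where "\<Theta> x n / (2 * pi) = of_int k"
      by (elim Ints_cases)
    then have "\<Theta> x n = 2 * pi * of_int k"
      by (simp add: field_simps)
    with False show False by blast
  qed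
  have "((\<lambda>y. \<Theta> y n / (2 * pi)) \<longlongrightarrow> \<Theta> x n / (2 * pi)) (at x)"
    using DERIV_isCont[OF deriv] by (intro tendsto_intros) (auto simp: isCont_def)
  \<comment> \<open>The floor function is locally constant at non-integers, and
    \<open>\<Theta> y n\<close> is continuous at \<open>x\<close>.\<close>
  then have "\<forall>\<^sub>F y in at x. \<lfloor>\<Theta> y n / (2 * pi)\<rfloor> = \<lfloor>\<Theta> x n / (2 * pi)\<rfloor>"
    by (rule eventually_floor_eq) (use nint in auto)
  then have "\<forall>\<^sub>F y in nhds x. \<lfloor>\<Theta> y n / (2 * pi)\<rfloor> = \<lfloor>\<Theta> x n / (2 * pi)\<rfloor>"
    by (simp add: eventually_nhds_conv_at)
  then have "\<forall>\<^sub>F y in nhds x. regular_obs \<Theta> x y n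
      = \<Theta> y n - 2 * pi * of_int \<lfloor>\<Theta> x n / (2 * pi)\<rfloor>"
    by eventually_elim (use False in \<open>simp add: regular_obs_def wrapped_def rmod_def\<close>)
  moreover have "((\<lambda>y. \<Theta> y n - 2 * pi * of_int \<lfloor>\<Theta> x n / (2 * pi)\<rfloor>) has_real_derivative c) (at x)"
    using deriv by (auto intro!: derivative_eq_intros)
  ultimately show ?thesis
    by (simp add: DERIV_cong_ev)
qed

text \<open>The normalizing factor does not depend on the mean, so only the quadratic exponent
  contributes. At \<open>y = x\<close> the regularized observation is the wrapped one, which makes
  the residuals centred under the sampling measure.\<close>

lemma score_eq:
  assumes \<sigma>: "\<sigma> > 0"
    and deriv: "\<And>n. n < N \<Longrightarrow> ((\<lambda>y. \<Theta> y n) has_real_derivative c n) (at x)"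
  shows "score N \<sigma> \<Theta> x z = (\<Sum>n<N. c n / \<sigma>\<^sup>2 * (z n - wrapped (\<Theta> x) n))"
proof -
  have "ln (gauss_density N \<sigma> \<mu> z)
      = - (\<Sum>n<N. (z n - \<mu> n)\<^sup>2) / (2 * \<sigma>\<^sup>2) - ln (sqrt ((2 * pi * \<sigma>\<^sup>2) ^ N))" for \<mu>
    using \<sigma> by (simp add: gauss_density_def ln_div)
  moreover have "((\<lambda>y. - (\<Sum>n<N. (z n - regular_obs \<Theta> x y n)\<^sup>2) / (2 * \<sigma>\<^sup>2)
        - ln (sqrt ((2 * pi * \<sigma>\<^sup>2) ^ N)))
      has_real_derivative (\<Sum>n<N. c n / \<sigma>\<^sup>2 * (z n - regular_obs \<Theta> x x n))) (at x)"
    using regular_obs_has_real_derivative[where \<Theta> = \<Theta> and x = x, OF deriv] \<sigma>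
    by (auto intro!: derivative_eq_intros sum.cong
        simp: sum_negf[symmetric] sum_divide_distrib field_simps)
  ultimately show ?thesis
    by (simp add: score_def regular_obs_self DERIV_imp_deriv)
qed

lemma fisher_information_eq:
  assumes \<sigma>: "\<sigma> > 0"
    and deriv: "\<And>n. n < N \<Longrightarrow> ((\<lambda>y. \<Theta> y n) has_real_derivative c n) (at x)"
  shows "fisher_information N \<sigma> \<Theta> x = (\<Sum>n<N. (c n)\<^sup>2) / \<sigma>\<^sup>2"
proof -
  have "score N \<sigma> \<Theta> x = (\<lambda>z. \<Sum>n<N. c n / \<sigma>\<^sup>2 * (z n - wrapped (\<Theta> x) n))"
    by (intro ext score_eq[OF \<sigma> deriv])
  then have "fisher_information N \<sigma> \<Theta> x = \<sigma>\<^sup>2 * (\<Sum>n<N. (c n / \<sigma>\<^sup>2)\<^sup>2)"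
    by (simp only: fisher_information_def integral_gauss_linear_squared[OF \<sigma>])
  then show ?thesis
    using \<sigma> by (simp add: power_divide sum_divide_distrib[symmetric] field_simps eval_nat_numeral)
qed

section \<open>Distances between source, reference location and antennas\<close>

text \<open>The direction vector is a unit vector. The radius may have any sign here, because it
  later serves as a differentiation variable.\<close>

lemma norm_spherical_point_minus_origin: "norm (spherical_point r a \<theta> \<phi> - r) = \<bar>a\<bar>"
proof -
  have "(norm (vector [cos \<phi> * sin \<theta>, sin \<phi> * sin \<theta>, cos \<theta>] :: real ^ 3))\<^sup>2
      = (cos \<phi> * sin \<theta>)\<^sup>2 + (sin \<phi> * sin \<theta>)\<^sup>2 + (cos \<theta>)\<^sup>2"
    unfolding power2_norm_eq_inner
    by (simp add: inner_vec_def sum_3 power2_eq_square)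
  also have "\<dots> = 1\<^sup>2"
    by (simp add: power_mult_distrib flip: distrib_right)
  finally have "norm (vector [cos \<phi> * sin \<theta>, sin \<phi> * sin \<theta>, cos \<theta>] :: real ^ 3) = 1"
    by (rule power2_eq_imp_eq) simp_all
  then show ?thesis
    by (simp add: spherical_point_def)
qed

text \<open>This is the law of cosines with sides \<open>a\<close> and \<open>D / 2\<close>:
  \<open>direction_factor\<close> is the inner product of the two unit direction vectors.\<close>

lemma norm_source_minus_antenna:
  "norm (spherical_point r a \<theta> \<phi> - antenna_position r D N n)
    = sqrt (4 * a\<^sup>2 + D\<^sup>2 - 4 * direction_factor N n \<theta> \<phi> * a * D) / 2"
proof -
  define p where "p = spherical_point r a \<theta> \<phi> - r"
  define q where "q = antenna_position r D N n - r"
  have "(norm p)\<^sup>2 = a\<^sup>2" "(norm q)\<^sup>2 = (D / 2)\<^sup>2"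
    by (simp_all add: p_def q_def norm_spherical_point_minus_origin antenna_position_def
        power_divide)
  moreover have "inner p q = a * (D / 2) * direction_factor N n \<theta> \<phi>"
    by (simp add: p_def q_def spherical_point_def antenna_position_def antenna_azimuth_def
        direction_factor_def inner_vec_def sum_3 cos_diff algebra_simps)
  ultimately have "(norm (p - q))\<^sup>2 = (4 * a\<^sup>2 + D\<^sup>2 - 4 * direction_factor N n \<theta> \<phi> * a * D) / 4"
    by (simp add: power2_norm_eq_inner inner_diff inner_commute field_simps)
  then have "norm (p - q) = sqrt ((4 * a\<^sup>2 + D\<^sup>2 - 4 * direction_factor N n \<theta> \<phi> * a * D) / 4)"
    \<comment> \<open>The radicand is already known to be the square of a norm, so its sign needs no
      separate argument.\<close>
    by (metis norm_ge_zero real_sqrt_unique)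
  then show ?thesis
    by (simp add: p_def q_def real_sqrt_divide)
qed

section \<open>Derivatives of the phase differences\<close>

lemma phase_difference_eq:
  "phase_difference lam r D N a \<theta> \<phi> n = 2 * pi / lam *
    (sqrt (4 * a\<^sup>2 + D\<^sup>2 - 4 * direction_factor N n \<theta> \<phi> * a * D) / 2 - \<bar>a\<bar>)"
  by (simp add: phase_difference_def path_difference_def norm_source_minus_antenna
      norm_spherical_point_minus_origin)

lemma phase_difference_has_real_derivative_distance:
  assumes "d > 0"
    and R: "4 * d\<^sup>2 + D\<^sup>2 - 4 * direction_factor N n \<theta> \<phi> * d * D > 0"
  shows "((\<lambda>x. phase_difference lam r D N x \<theta> \<phi> n) has_real_derivative 2 * pi / lam *
    ((2 * d - direction_factor N n \<theta> \<phi> * D)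
      / sqrt (4 * d\<^sup>2 + D\<^sup>2 - 4 * direction_factor N n \<theta> \<phi> * d * D) - 1)) (at d)"
proof -
  \<comment> \<open>The absolute value agrees with the identity on the positive half-line, an open
    set containing \<open>d\<close>.\<close>
  have "((\<lambda>x. \<bar>x\<bar>) has_real_derivative 1) (at d)"
    by (rule has_field_derivative_transform_within_open[of "\<lambda>x. x" _ _ "{0<..}"])
      (use \<open>d > 0\<close> in auto)
  then show ?thesis
    unfolding phase_difference_eq using R
    by (intro DERIV_cmult) (auto intro!: derivative_eq_intros simp: field_simps)
qed

text \<open>At fixed distance the phase depends on the angles only through
  \<open>direction_factor\<close>. Letting both angles be functions of \<open>x\<close> covers
  elevation and azimuth at once.\<close>

lemma phase_difference_has_real_derivative_direction:
  assumes g: "((\<lambda>x. direction_factor N n (\<theta> x) (\<phi> x)) has_real_derivative g') (at x)"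
    and R: "4 * d\<^sup>2 + D\<^sup>2 - 4 * direction_factor N n (\<theta> x) (\<phi> x) * d * D > 0"
  shows "((\<lambda>x. phase_difference lam r D N d (\<theta> x) (\<phi> x) n) has_real_derivative
    2 * pi / lam * (- d * D * g'
      / sqrt (4 * d\<^sup>2 + D\<^sup>2 - 4 * direction_factor N n (\<theta> x) (\<phi> x) * d * D))) (at x)"
  unfolding phase_difference_eq using R
  by (intro DERIV_cmult) (auto intro!: derivative_eq_intros g simp: field_simps)

lemma fisher_information_direction:
  assumes \<sigma>: "\<sigma> > 0"
    and g: "\<And>n. n < N \<Longrightarrow>
      (\<lambda>x. direction_factor N n (\<theta> x) (\<phi> x)) field_differentiable (at x)"
    and R: "\<And>n. n < N \<Longrightarrow>
      4 * d\<^sup>2 + D\<^sup>2 - 4 * direction_factor N n (\<theta> x) (\<phi> x) * d * D > 0"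
  shows "fisher_information N \<sigma> (\<lambda>x. phase_difference lam r D N d (\<theta> x) (\<phi> x)) x =
      4 * pi\<^sup>2 / (lam\<^sup>2 * \<sigma>\<^sup>2) *
      (\<Sum>n<N. d\<^sup>2 * D\<^sup>2 / (D\<^sup>2 + 4 * d\<^sup>2 - 4 * direction_factor N n (\<theta> x) (\<phi> x) * d * D)
        * (deriv (\<lambda>x. direction_factor N n (\<theta> x) (\<phi> x)) x)\<^sup>2)"
proof -
  have g': "((\<lambda>x. direction_factor N n (\<theta> x) (\<phi> x)) has_real_derivative
      deriv (\<lambda>x. direction_factor N n (\<theta> x) (\<phi> x)) x) (at x)" if "n < N" for n
    using g[OF that] by (simp add: DERIV_deriv_iff_field_differentiable)
  have "fisher_information N \<sigma> (\<lambda>x. phase_difference lam r D N d (\<theta> x) (\<phi> x)) x =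
      (\<Sum>n<N. (2 * pi / lam * (- d * D * deriv (\<lambda>x. direction_factor N n (\<theta> x) (\<phi> x)) x /
        sqrt (4 * d\<^sup>2 + D\<^sup>2 - 4 * direction_factor N n (\<theta> x) (\<phi> x) * d * D)))\<^sup>2) / \<sigma>\<^sup>2"
    by (intro fisher_information_eq phase_difference_has_real_derivative_direction \<sigma> g' R)
  \<comment> \<open>Squaring removes the minus sign and, the radicand being positive, the
    root.\<close>
  also have "\<dots> = (\<Sum>n<N. 4 * pi\<^sup>2 / (lam\<^sup>2 * \<sigma>\<^sup>2) *
      (d\<^sup>2 * D\<^sup>2 / (D\<^sup>2 + 4 * d\<^sup>2 - 4 * direction_factor N n (\<theta> x) (\<phi> x) * d * D)
        * (deriv (\<lambda>x. direction_factor N n (\<theta> x) (\<phi> x)) x)\<^sup>2))"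
    unfolding sum_divide_distrib
    by (intro sum.cong refl)
      (use R in \<open>simp add: power_divide power_mult_distrib add.commute less_imp_le\<close>)
  finally show ?thesis
    by (simp only: sum_distrib_left)
qed

section \<open>The three Fisher informations\<close>

theorem proposition3:
  fixes lam \<sigma> D d \<theta> \<phi> :: real and N :: nat and r :: "real ^ 3"
  assumes "lam > 0" and "\<sigma> > 0" and "D > 0" and "d > 0"
    and "\<And>n. n < N \<Longrightarrow> spherical_point r d \<theta> \<phi> \<noteq> antenna_position r D N n"
  shows "fisher_information N \<sigma> (\<lambda>x. phase_difference lam r D N x \<theta> \<phi>) d =
      4 * pi\<^sup>2 / (lam\<^sup>2 * \<sigma>\<^sup>2) *
      (\<Sum>n<N. let g = direction_factor N n \<theta> \<phi> in
        (8 * d\<^sup>2 + D\<^sup>2 * (g\<^sup>2 + 1) - 8 * g * d * D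
          - 2 * (2 * d - g * D) * sqrt (4 * d\<^sup>2 + D\<^sup>2 - 4 * g * d * D))
        / (4 * d\<^sup>2 + D\<^sup>2 - 4 * g * d * D))
    \<and> fisher_information N \<sigma> (\<lambda>x. phase_difference lam r D N d x \<phi>) \<theta> =
      4 * pi\<^sup>2 / (lam\<^sup>2 * \<sigma>\<^sup>2) *
      (\<Sum>n<N. d\<^sup>2 * D\<^sup>2 / (D\<^sup>2 + 4 * d\<^sup>2 - 4 * direction_factor N n \<theta> \<phi> * d * D)
        * (deriv (\<lambda>x. direction_factor N n x \<phi>) \<theta>)\<^sup>2)
    \<and> fisher_information N \<sigma> (\<lambda>x. phase_difference lam r D N d \<theta> x) \<phi> =
      4 * pi\<^sup>2 / (lam\<^sup>2 * \<sigma>\<^sup>2) *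
      (\<Sum>n<N. d\<^sup>2 * D\<^sup>2 / (D\<^sup>2 + 4 * d\<^sup>2 - 4 * direction_factor N n \<theta> \<phi> * d * D)
        * (deriv (\<lambda>x. direction_factor N n \<theta> x) \<phi>)\<^sup>2)"
proof (intro conjI)
  \<comment> \<open>The radicand is four times the squared distance from source to antenna, positive
    because the two points differ.\<close>
  have R: "4 * d\<^sup>2 + D\<^sup>2 - 4 * direction_factor N n \<theta> \<phi> * d * D > 0" if "n < N" for n
  proof -
    have "norm (spherical_point r d \<theta> \<phi> - antenna_position r D N n) > 0"
      using assms(5)[OF that] by simp
    then show ?thesis
      by (simp add: norm_source_minus_antenna)
  qed
  show "fisher_information N \<sigma> (\<lambda>x. phase_difference lam r D N d x \<phi>) \<theta> =
      4 * pi\<^sup>2 / (lam\<^sup>2 * \<sigma>\<^sup>2) *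
      (\<Sum>n<N. d\<^sup>2 * D\<^sup>2 / (D\<^sup>2 + 4 * d\<^sup>2 - 4 * direction_factor N n \<theta> \<phi> * d * D)
        * (deriv (\<lambda>x. direction_factor N n x \<phi>) \<theta>)\<^sup>2)"
    using R by (intro fisher_information_direction[where \<theta> = "\<lambda>x. x" and \<phi> = "\<lambda>_. \<phi>"] \<open>\<sigma> > 0\<close>)
      (auto simp: direction_factor_def field_differentiable_def intro!: derivative_eq_intros exI)
  show "fisher_information N \<sigma> (\<lambda>x. phase_difference lam r D N d \<theta> x) \<phi> =
      4 * pi\<^sup>2 / (lam\<^sup>2 * \<sigma>\<^sup>2) *
      (\<Sum>n<N. d\<^sup>2 * D\<^sup>2 / (D\<^sup>2 + 4 * d\<^sup>2 - 4 * direction_factor N n \<theta> \<phi> * d * D)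
        * (deriv (\<lambda>x. direction_factor N n \<theta> x) \<phi>)\<^sup>2)"
    using R by (intro fisher_information_direction[where \<theta> = "\<lambda>_. \<theta>" and \<phi> = "\<lambda>x. x"] \<open>\<sigma> > 0\<close>)
      (auto simp: direction_factor_def field_differentiable_def intro!: derivative_eq_intros exI)
  have fisher: "fisher_information N \<sigma> (\<lambda>x. phase_difference lam r D N x \<theta> \<phi>) d =
      (\<Sum>n<N. (2 * pi / lam * ((2 * d - direction_factor N n \<theta> \<phi> * D)
        / sqrt (4 * d\<^sup>2 + D\<^sup>2 - 4 * direction_factor N n \<theta> \<phi> * d * D) - 1))\<^sup>2) / \<sigma>\<^sup>2"
    by (intro fisher_information_eq phase_difference_has_real_derivative_distance
        \<open>\<sigma> > 0\<close> \<open>d > 0\<close> R)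
  show "fisher_information N \<sigma> (\<lambda>x. phase_difference lam r D N x \<theta> \<phi>) d =
      4 * pi\<^sup>2 / (lam\<^sup>2 * \<sigma>\<^sup>2) *
      (\<Sum>n<N. let g = direction_factor N n \<theta> \<phi> in
        (8 * d\<^sup>2 + D\<^sup>2 * (g\<^sup>2 + 1) - 8 * g * d * D
          - 2 * (2 * d - g * D) * sqrt (4 * d\<^sup>2 + D\<^sup>2 - 4 * g * d * D))
        / (4 * d\<^sup>2 + D\<^sup>2 - 4 * g * d * D))"
    unfolding fisher sum_distrib_left sum_divide_distrib Let_def
  proof (rule sum.cong[OF refl])
    fix n assume "n \<in> {..<N}"
    define g where "g = direction_factor N n \<theta> \<phi>"
    define R where "R = sqrt (4 * d\<^sup>2 + D\<^sup>2 - 4 * g * d * D)"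
    have R2: "4 * d\<^sup>2 + D\<^sup>2 - 4 * g * d * D = R\<^sup>2" and "R > 0"
      using R[of n] \<open>n \<in> {..<N}\<close> by (simp_all add: R_def g_def)
    \<comment> \<open>This splitting exhibits the claimed fraction as the expanded square of
      \<open>(2 * d - g * D) / R - 1\<close>, the phase derivative up to the factor
      \<open>2 * pi / lam\<close>.\<close>
    have num: "8 * d\<^sup>2 + D\<^sup>2 * (g\<^sup>2 + 1) - 8 * g * d * D = (2 * d - g * D)\<^sup>2 + R\<^sup>2"
      unfolding R2[symmetric] by (simp add: power2_eq_square algebra_simps)
    have "(2 * pi / lam * ((2 * d - g * D) / R - 1))\<^sup>2 / \<sigma>\<^sup>2 = 4 * pi\<^sup>2 / (lam\<^sup>2 * \<sigma>\<^sup>2) *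
        (((2 * d - g * D)\<^sup>2 + R\<^sup>2 - 2 * (2 * d - g * D) * R) / R\<^sup>2)"
    proof -
      have "((2 * d - g * D) / R - 1)\<^sup>2
          = ((2 * d - g * D)\<^sup>2 + R\<^sup>2 - 2 * (2 * d - g * D) * R) / R\<^sup>2"
        using \<open>R > 0\<close> by (simp add: field_simps power2_eq_square)
      then show ?thesis
        by (simp add: power_mult_distrib power_divide)
    qed
    then show "(2 * pi / lam * ((2 * d - direction_factor N n \<theta> \<phi> * D)
          / sqrt (4 * d\<^sup>2 + D\<^sup>2 - 4 * direction_factor N n \<theta> \<phi> * d * D) - 1))\<^sup>2 / \<sigma>\<^sup>2 =
        4 * pi\<^sup>2 / (lam\<^sup>2 * \<sigma>\<^sup>2) *
        ((8 * d\<^sup>2 + D\<^sup>2 * ((direction_factor N n \<theta> \<phi>)\<^sup>2 + 1) - 8 * direction_factor N n \<theta> \<phi> * d * D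
          - 2 * (2 * d - direction_factor N n \<theta> \<phi> * D)
            * sqrt (4 * d\<^sup>2 + D\<^sup>2 - 4 * direction_factor N n \<theta> \<phi> * d * D))
        / (4 * d\<^sup>2 + D\<^sup>2 - 4 * direction_factor N n \<theta> \<phi> * d * D))"
      unfolding g_def[symmetric] R_def[symmetric] num
      unfolding R2 .
  qed
qed

end
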